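(* The following arrows are degenerations among $\mathcal{N}_4(\mathbb{C})$, so that the Hasse diagram formed by them captures several transitive degeneration relations among $\mathcal{N}_4(\mathbb{C})$: $$\mu_{4,12}\to\mu_{4,11},\quad \mu_{4,12}\to\mu_{4,10},\quad \mu_{4,12}\to\mu_{4,8},\quad \mu_{4,11}\to\mu_{4,7},\quad \mu_{4,10}\to\mu_{4,9},\quad \mu_{4,9}\to\mu_{4,6},\quad \mu_{4,8}\to\mu_{4,6},$$ $$\mu_{4,7}\to\mu_{4,6},\quad \mu_{4,7}\to\mu_{4,5},\quad \mu_{4,6}\to\mu_{4,3},\quad \mu_{4,5}\to\mu_{4,4},\quad \mu_{4,4}\to\mu_{4,3},\quad \mu_{4,3}\to\mu_{4,2},\quad \mu_{4,2}\to\mu_{4,1}.$$ Particularly, the diagram represents all transitive degenerations among the algebras $\{\mu_{4,i}\}_{i=1}^7$: for distinct $i,j\in\{1,\dots,7\}$, $\mu_{4,i}\rightsquigarrow\mu_{4,j}$ among $\{\mu_{4,1},\dots,\mu_{4,7}\}$ if and only if there is a directed path from $\mu_{4,i}$ to $\mu_{4,j}$ formed by the arrows $\mu_{4,7}\to\mu_{4,6}$, $\mu_{4,7}\to\mu_{4,5}$, $\mu_{4,6}\to\mu_{4,3}$, $\mu_{4,5}\to\mu_{4,4}$, $\mu_{4,4}\to\mu_{4,3}$, $\mu_{4,3}\to\mu_{4,2}$, $\mu_{4,2}\to\mu_{4,1}$.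
   Context: An evolution algebra over $\mathbb{C}$ is a finite-dimensional complex vector space $V$ with a bilinear product $\mu$ admitting a basis $\{e_1,\dots,e_n\}$ (natural basis) with $\mu(e_i,e_j)=0$ for $i\ne j$; it is denoted by its product $\mu$, and $e_i^2=\mu(e_i,e_i)$. $\mathcal{N}_4(\mathbb{C})$ denotes the four-dimensional nilpotent evolution algebras over $\mathbb{C}$, which up to isomorphism are (here $i=\sqrt{-1}$ in $\mu_{4,8}$): - $\mu_{4,1}$: $e_1^2=e_2^2=e_3^2=e_4^2=0$; - $\mu_{4,2}$: $e_1^2=e_2,\ e_2^2=e_3^2=e_4^2=0$; - $\mu_{4,3}$: $e_1^2=e_2^2=e_3,\ e_3^2=e_4^2=0$; - $\mu_{4,4}$: $e_1^2=e_3,\ e_2^2=e_4,\ e_3^2=e_4^2=0$; - $\mu_{4,5}$: $e_1^2=e_2,\ e_2^2=e_4,\ e_3^2=e_4^2=0$; - $\mu_{4,6}$: $e_1^2=e_2^2=e_3^2=e_4,\ e_4^2=0$; - $\mu_{4,7}$: $e_1^2=e_2,\ e_2^2=e_3^2=e_4,\ e_4^2=0$; - $\mu_{4,8}$: $e_1^2=e_2+ie_3,\ e_2^2=e_3^2=e_4,\ e_4^2=0$; - $\mu_{4,9}$: $e_1^2=e_2^2=e_3,\ e_3^2=e_4,\ e_4^2=0$; - $\mu_{4,10}$: $e_1^2=e_3,\ e_2^2=e_3+e_4,\ e_3^2=e_4,\ e_4^2=0$; - $\mu_{4,11}$: $e_1^2=e_2,\ e_2^2=e_3,\ e_3^2=e_4,\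 e_4^2=0$; - $\mu_{4,12}$: $e_1^2=e_2+e_3,\ e_2^2=e_3,\ e_3^2=e_4,\ e_4^2=0$. Degeneration: for $g\in\operatorname{GL}(n,\mathbb{C})$, $(g\cdot\mu)(x,y)=g(\mu(g^{-1}x,g^{-1}y))$. The matrix $g$ defines a natural basis change of $\mu$ if it represents a change from the given natural basis to another natural basis; i.e., in coordinates, with $f_1,\dots,f_n$ denoting the basis vectors for the transformed product, $(g\cdot\mu)(f_i,f_j)=0$ for all $i\ne j$. $\lambda$ is a (formal evolution) degeneration of $\mu$, written $\mu\rightarrow\lambda$, if there is a continuous map $g\colon(0,1]\to\operatorname{GL}(n,\mathbb{C})$, $t\mapsto g_t$, with each $g_t$ defining a natural basis change of $\mu$, such that $\lambda=\lim_{t\to0}g_t\cdot\mu$ (convergence of structure constants). For a family $\mathcal{F}$ of evolution algebras and $\mu,\lambda\in\mathcal{F}$, $\lambda$ is a transitive degeneration of $\mu$ among $\mathcal{F}$, written $\mu\rightsquigarrow\lambda$, if there is a finite sequence of degenerations $\mu=\mu_0\rightarrow\mu_1\rightarrow\cdots\rightarrow\mu_k=\lambda$ with all $\mu_i\in\mathcal{F}$. *)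

theory Defs
  imports "HOL-Analysis.Analysis"
begin

text \<open>
  An algebra on the coordinate space \<open>\<complex>\<^sup>n\<close> is identified with its product
  \<open>\<mu> :: complex^'n \<Rightarrow> complex^'n \<Rightarrow> complex^'n\<close>. Bilinearity is over the complex numbers;
  the library constant \<open>bilinear\<close> is only real-bilinearity.
\<close>

type_synonym 'n product = "complex^'n \<Rightarrow> complex^'n \<Rightarrow> complex^'n"

abbreviation unit_vec :: "'n \<Rightarrow> complex^'n" where
  "unit_vec i \<equiv> axis i 1"

definition complex_bilinear :: "'n::finite product \<Rightarrow> bool" where
  "complex_bilinear \<mu> \<longleftrightarrow>
     (\<forall>x. Vector_Spaces.linear (*s) (*s) (\<lambda>y. \<mu> x y)) \<and>
     (\<forall>y. Vector_Spaces.linear (*s) (*s) (\<lambda>x. \<mu> x y))"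

definition natural_basis :: "'n::finite product \<Rightarrow> ('n \<Rightarrow> complex^'n) \<Rightarrow> bool" where
  "natural_basis \<mu> b \<longleftrightarrow>
     inj b \<and> vec.independent (range b) \<and> vec.span (range b) = UNIV \<and>
     (\<forall>i j. i \<noteq> j \<longrightarrow> \<mu> (b i) (b j) = 0)"

text \<open>
  Natural basis changes and degenerations refer to a given natural basis. Products are
  written in coordinates with respect to that basis, so it is always the standard basis.
\<close>

definition evolution_algebra :: "'n::finite product \<Rightarrow> bool" where
  "evolution_algebra \<mu> \<longleftrightarrow> complex_bilinear \<mu> \<and> natural_basis \<mu> unit_vec"

text \<open>
  Powers of a nonassociative algebra \<open>A\<close>: \<open>A\<^sup>1 = A\<close> and \<open>A\<^sup>m\<close> is the span of all
  \<open>A\<^sup>i A\<^sup>j\<close> with \<open>i, j \<ge> 1\<close> and \<open>i + j = m\<close>. The value at exponent 0 is a dummy.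
\<close>

function alg_power :: "'n::finite product \<Rightarrow> nat \<Rightarrow> (complex^'n) set" where
  "alg_power \<mu> 0 = UNIV"
| "alg_power \<mu> (Suc 0) = UNIV"
| "alg_power \<mu> (Suc (Suc m)) =
     vec.span (\<Union>i\<in>{1..Suc m}.
       (\<lambda>(x, y). \<mu> x y) ` (alg_power \<mu> i \<times> alg_power \<mu> (Suc (Suc m) - i)))"
  by pat_completeness auto
termination by (relation "Wellfounded.measure snd") auto

definition nilpotent_algebra :: "'n::finite product \<Rightarrow> bool" where
  "nilpotent_algebra \<mu> \<longleftrightarrow> (\<exists>m\<ge>1. alg_power \<mu> m = {0})"

definition N4 :: "4 product set" where
  "N4 = {\<mu>. evolution_algebra \<mu> \<and> nilpotent_algebra \<mu>}"

definition act :: "complex^'n^'n \<Rightarrow> 'n::finite product \<Rightarrow> 'n product" where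
  "act g \<mu> = (\<lambda>x y. g *v \<mu> (matrix_inv g *v x) (matrix_inv g *v y))"

definition natural_basis_change :: "complex^'n^'n \<Rightarrow> 'n::finite product \<Rightarrow> bool" where
  "natural_basis_change g \<mu> \<longleftrightarrow>
     invertible g \<and> (\<forall>i j. i \<noteq> j \<longrightarrow> act g \<mu> (unit_vec i) (unit_vec j) = 0)"

definition degenerates :: "'n::finite product \<Rightarrow> 'n product \<Rightarrow> bool" where
  "degenerates \<mu> \<nu> \<longleftrightarrow>
     (\<exists>g :: real \<Rightarrow> complex^'n^'n.
        continuous_on {0<..1} g \<and>
        (\<forall>t\<in>{0<..1}. natural_basis_change (g t) \<mu>) \<and>
        (\<forall>i j k. ((\<lambda>t. act (g t) \<mu> (unit_vec i) (unit_vec j) $ k)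
                    \<longlongrightarrow> \<nu> (unit_vec i) (unit_vec j) $ k) (at_right 0)))"

definition transitively_degenerates ::
    "'n::finite product set \<Rightarrow> 'n product \<Rightarrow> 'n product \<Rightarrow> bool" where
  "transitively_degenerates F \<mu> \<nu> \<longleftrightarrow>
     (\<exists>(k::nat) \<sigma>. \<sigma> 0 = \<mu> \<and> \<sigma> k = \<nu> \<and> (\<forall>m\<le>k. \<sigma> m \<in> F) \<and>
        (\<forall>m<k. degenerates (\<sigma> m) (\<sigma> (Suc m))))"

text \<open>
  \<open>evolution_product s\<close> is the evolution algebra with \<open>e\<^sub>i\<^sup>2 = s i\<close>. In the index type \<open>4\<close>
  the numerals 1, 2, 3, 4 are its four distinct elements (4 = 0 there).
\<close>

definition evolution_product :: "('n::finite \<Rightarrow> complex^'n) \<Rightarrow> 'n product" where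
  "evolution_product s = (\<lambda>x y. \<Sum>i\<in>UNIV. (x $ i * y $ i) *s s i)"

definition squares4 :: "complex^4 \<Rightarrow> complex^4 \<Rightarrow> complex^4 \<Rightarrow> complex^4 \<Rightarrow> 4 product" where
  "squares4 a b c d = evolution_product
     (\<lambda>i. if i = 1 then a else if i = 2 then b else if i = 3 then c else d)"

text \<open>\<open>mu4 m\<close> is the algebra \<open>\<mu>\<^sub>4\<^sub>,\<^sub>m\<close>; only \<open>m \<in> {1..12}\<close> is meaningful.\<close>

definition mu4 :: "nat \<Rightarrow> 4 product" where
  "mu4 m =
     (let e = (unit_vec :: 4 \<Rightarrow> complex^4) in
      [squares4 0 0 0 0,
       squares4 (e 2) 0 0 0,
       squares4 (e 3) (e 3) 0 0,
       squares4 (e 3) (e 4) 0 0,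
       squares4 (e 2) (e 4) 0 0,
       squares4 (e 4) (e 4) (e 4) 0,
       squares4 (e 2) (e 4) (e 4) 0,
       squares4 (e 2 + \<i> *s e 3) (e 4) (e 4) 0,
       squares4 (e 3) (e 3) (e 4) 0,
       squares4 (e 3) (e 3 + e 4) (e 4) 0,
       squares4 (e 2) (e 3) (e 4) 0,
       squares4 (e 2 + e 3) (e 3) (e 4) 0] ! (m - 1))"

definition arrows :: "(nat \<times> nat) set" where
  "arrows = {(12, 11), (12, 10), (12, 8), (11, 7), (10, 9), (9, 6), (8, 6),
             (7, 6), (7, 5), (6, 3), (5, 4), (4, 3), (3, 2), (2, 1)}"

definition arrows7 :: "(nat \<times> nat) set" where
  "arrows7 = {(7, 6), (7, 5), (6, 3), (5, 4), (4, 3), (3, 2), (2, 1)}"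

end

theory Submission
  imports Defs
begin

text \<open>
  Each arrow is realized by an explicit family of natural bases, depending rationally on a
  parameter \<open>z\<close> and with structure constants polynomial in \<open>z\<close>. Among the first seven
  algebras, all other degenerations are excluded by three properties that survive natural basis
  changes and limits: the number of nonzero squares in a natural basis does not increase,
  \<open>dim A\<^sup>2 \<le> 1\<close> is a vanishing of minors of the structure constants, and \<open>A\<^sup>2 A = 0\<close> is a
  vanishing of products of structure constants. Their values on \<open>\<mu>\<^sub>4\<^sub>,\<^sub>1, \<dots>, \<mu>\<^sub>4\<^sub>,\<^sub>7\<close> are
  \<open>0, 1, 2, 2, 2, 3, 3\<close> nonzero squares; \<open>dim A\<^sup>2 \<le> 1\<close> fails exactly for indices 4, 5, 7, and
  \<open>A\<^sup>2 A = 0\<close> exactly for 5, 7.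
\<close>

section \<open>Evolution products\<close>

lemma complex_bilinear_sum_left:
  assumes "complex_bilinear \<mu>"
  shows "\<mu> (\<Sum>i\<in>I. c i *s x i) y = (\<Sum>i\<in>I. c i *s \<mu> (x i) y)"
proof -
  interpret Vector_Spaces.linear "(*s)" "(*s)" "\<lambda>x. \<mu> x y"
    using assms by (simp add: complex_bilinear_def)
  show ?thesis by (simp add: sum scale)
qed

lemma complex_bilinear_zero_left:
  assumes "complex_bilinear \<mu>"
  shows "\<mu> 0 y = 0"
  using complex_bilinear_sum_left[OF assms, of _ _ "{}"] by simp

lemma complex_bilinear_evolution_product: "complex_bilinear (evolution_product s)"
  unfolding complex_bilinear_def evolution_product_def
  by (intro conjI allI; unfold_locales)
     (simp_all add: vec_eq_iff algebra_simps sum.distrib sum_distrib_left)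

lemma evolution_product_unit_vec:
  "evolution_product s (unit_vec i) (unit_vec j) = (if i = j then s i else 0)"
proof -
  have "evolution_product s (unit_vec i) (unit_vec j)
      = (\<Sum>k\<in>UNIV. if k = i then (if i = j then s i else 0) else 0)"
    unfolding evolution_product_def by (intro sum.cong) (auto simp: axis_def)
  then show ?thesis by simp
qed

lemma natural_basis_unit_vec_evolution_product:
  fixes s :: "'n::finite \<Rightarrow> complex^'n"
  shows "natural_basis (evolution_product s) unit_vec"
proof -
  have "range unit_vec = (cart_basis :: (complex^'n) set)"
    by (auto simp: cart_basis_def)
  then show ?thesis
    unfolding natural_basis_def
    by (simp add: inj_on_def axis_eq_axis evolution_product_unit_vec independent_cart_basis)
qed

lemma evolution_algebra_evolution_product: "evolution_algebra (evolution_product s)"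
  by (simp add: evolution_algebra_def complex_bilinear_evolution_product
      natural_basis_unit_vec_evolution_product)

text \<open>
  A splitting \<open>m = i + j\<close> only guarantees that one of the two factors lies in a power of
  exponent at least \<open>m / 2\<close>; hence the doubling of the weights.
\<close>

lemma alg_power_weight:
  fixes w :: "'n::finite \<Rightarrow> nat"
  assumes w: "\<And>i k. s i $ k \<noteq> 0 \<Longrightarrow> 2 * w i \<le> w k" and pos: "\<And>i. 0 < w i"
  shows "x \<in> alg_power (evolution_product s) m \<Longrightarrow> w k < m \<Longrightarrow> x $ k = 0"
proof (induction m arbitrary: x k rule: less_induct)
  case (less m)
  \<comment> \<open>Positive weights exclude the exponents 0 and 1, whose powers are the whole
    space.\<close>
  have "2 \<le> m"
    using less.prems(2) pos[of k] by linarith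
  then obtain n where m: "m = Suc (Suc n)"
    by (metis add_2_eq_Suc le_Suc_ex)
  let ?W = "{x :: complex^'n. \<forall>k. w k < m \<longrightarrow> x $ k = 0}"
  have "evolution_product s y z \<in> ?W"
    if i: "i \<in> {1..Suc n}" and y: "y \<in> alg_power (evolution_product s) i"
      and z: "z \<in> alg_power (evolution_product s) (m - i)" for i y z
  proof -
    \<comment> \<open>A nonzero term would give \<open>i \<le> w l\<close> and
      \<open>m - i \<le> w l\<close> by induction, hence
      \<open>m \<le> 2 * w l \<le> w k\<close>.\<close>
    have "y $ l * z $ l * s l $ k = 0" if k: "w k < m" for l k
    proof (rule ccontr)
      assume nz: "\<not> ?thesis"
      then have "2 * w l \<le> w k" using w by auto
      moreover have "i \<le> w l"
        by (rule ccontr) (use less.IH[OF _ y, of l] nz i m in auto)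
      moreover have "m - i \<le> w l"
        by (rule ccontr) (use less.IH[OF _ z, of l] nz i m in auto)
      ultimately show False using k by linarith
    qed
    then show ?thesis by (auto simp: evolution_product_def intro!: sum.neutral)
  qed
  then have "alg_power (evolution_product s) m \<subseteq> vec.span ?W"
    unfolding m alg_power.simps by (intro vec.span_mono) auto
  also have "vec.span ?W = ?W"
    by (auto simp: vec.span_eq_iff vec.subspace_def)
  finally show ?case using less.prems by auto
qed

text \<open>The m-th power is supported on coordinates of weight at least m, and no coordinate is
  left once m exceeds the largest weight.\<close>

lemma nilpotent_evolution_product:
  fixes w :: "'n::finite \<Rightarrow> nat"
  assumes w: "\<And>i k. s i $ k \<noteq> 0 \<Longrightarrow> 2 * w i \<le> w k" and pos: "\<And>i. 0 < w i"
  shows "nilpotent_algebra (evolution_product s)"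
proof -
  \<comment> \<open>One \<open>Suc\<close> passes the largest weight; the other gives the shape in
    which \<open>alg_power\<close> unfolds to a span, which contains 0.\<close>
  define m where "m = Suc (Suc (Max (range w)))"
  have "w k < m" for k
    unfolding m_def by (intro less_SucI le_imp_less_Suc Max_ge) auto
  then have "alg_power (evolution_product s) m \<subseteq> {0}"
    using alg_power_weight[where s = s and w = w, OF w pos] by (auto simp: vec_eq_iff)
  moreover have "0 \<in> alg_power (evolution_product s) m"
    unfolding m_def by (simp add: vec.span_zero)
  ultimately show ?thesis
    unfolding nilpotent_algebra_def m_def by (intro exI[of _ m]) (auto simp: m_def)
qed

section \<open>Invariants of degenerations\<close>

lemma matrix_inv_eqI:
  fixes g h :: "'a::field^'n^'n"
  assumes "g ** h = mat 1"
  shows "invertible g" and "matrix_inv g = h"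
proof -
  have hg: "h ** g = mat 1" using assms by (simp add: matrix_left_right_inverse)
  with assms show inv: "invertible g" by (auto simp: invertible_def)
  then have "matrix_inv g ** g = mat 1"
    unfolding invertible_def matrix_inv_def by (metis (mono_tags, lifting) someI_ex)
  then show "matrix_inv g = h"
    by (metis assms matrix_mul_assoc matrix_mul_lid matrix_mul_rid)
qed

lemma matrix_inv_mult:
  fixes g :: "'a::field^'n^'n"
  assumes "invertible g"
  shows "matrix_inv g ** g = mat 1"
proof -
  obtain h where "g ** h = mat 1" "h ** g = mat 1"
    using assms by (auto simp: invertible_def)
  then show ?thesis using matrix_inv_eqI by metis
qed

text \<open>The inner \<open>matrix_inv g ** g\<close> cancels, so the identity (xy)z = 0 passes to
  every transformed product.\<close>

lemma act_act:
  assumes "invertible g"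
  shows "act g \<mu> (act g \<mu> x y) z
       = g *v \<mu> (\<mu> (matrix_inv g *v x) (matrix_inv g *v y)) (matrix_inv g *v z)"
  by (simp add: act_def matrix_vector_mul_assoc matrix_inv_mult[OF assms])

lemma complex_bilinear_act:
  assumes "complex_bilinear \<mu>"
  shows "complex_bilinear (act g \<mu>)"
proof -
  have "Vector_Spaces.linear (*s) (*s) (\<lambda>y. g *v f (matrix_inv g *v y))"
    if "Vector_Spaces.linear (*s) (*s) f" for f :: "complex^'a \<Rightarrow> complex^'a"
    using Vector_Spaces.linear_compose[OF Vector_Spaces.linear_compose
        [OF matrix_vector_mul_linear_gen that] matrix_vector_mul_linear_gen]
    by (simp add: o_def)
  then show ?thesis
    using assms unfolding complex_bilinear_def act_def by blast
qed

text \<open>The obstructions are read off near t = 0, so the condition on (0,1] is restated as an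
  eventual one that combines with limits.\<close>

lemma degenerates_limit:
  fixes \<mu> \<nu> :: "'n::finite product"
  assumes "degenerates \<mu> \<nu>"
  shows "\<exists>g :: real \<Rightarrow> complex^'n^'n.
    eventually (\<lambda>t. natural_basis_change (g t) \<mu>) (at_right 0) \<and>
    (\<forall>i j k. ((\<lambda>t. act (g t) \<mu> (unit_vec i) (unit_vec j) $ k)
            \<longlongrightarrow> \<nu> (unit_vec i) (unit_vec j) $ k) (at_right 0))"
proof -
  obtain g :: "real \<Rightarrow> complex^'n^'n"
    where g: "\<forall>t\<in>{0<..1}. natural_basis_change (g t) \<mu>"
      and lim: "\<forall>i j k. ((\<lambda>t. act (g t) \<mu> (unit_vec i) (unit_vec j) $ k)
                \<longlongrightarrow> \<nu> (unit_vec i) (unit_vec j) $ k) (at_right 0)"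
    using assms unfolding degenerates_def by blast
  have "eventually (\<lambda>t. t \<in> {0<..1::real}) (at_right 0)"
    by (auto simp: eventually_at_right_field intro: exI[of _ 1])
  then have "eventually (\<lambda>t. natural_basis_change (g t) \<mu>) (at_right 0)"
    by (rule eventually_mono) (use g in blast)
  with lim show ?thesis by blast
qed

text \<open>If all products lie on the line through v, all transformed products lie on the line
  through g v. The 2x2 minors formed by two squares then vanish, and so do their limits.\<close>

lemma degenerates_parallel_squares:
  assumes deg: "degenerates \<mu> \<nu>" and par: "\<And>x y. \<exists>c. \<mu> x y = c *s v"
  shows "\<nu> (unit_vec i) (unit_vec i) $ k * \<nu> (unit_vec j) (unit_vec j) $ l
       = \<nu> (unit_vec i) (unit_vec i) $ l * \<nu> (unit_vec j) (unit_vec j) $ k"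
proof -
  obtain g where "eventually (\<lambda>t. natural_basis_change (g t) \<mu>) (at_right 0)"
    and lim: "\<And>i j k. ((\<lambda>t. act (g t) \<mu> (unit_vec i) (unit_vec j) $ k)
            \<longlongrightarrow> \<nu> (unit_vec i) (unit_vec j) $ k) (at_right (0::real))"
    using degenerates_limit[OF deg] by blast
  have swap: "act h \<mu> x x $ k * act h \<mu> y y $ l = act h \<mu> x x $ l * act h \<mu> y y $ k" for h x y
  proof -
    obtain c where c: "\<mu> (matrix_inv h *v x) (matrix_inv h *v x) = c *s v"
      using par by blast
    obtain d where d: "\<mu> (matrix_inv h *v y) (matrix_inv h *v y) = d *s v"
      using par by blast
    show ?thesis by (simp add: act_def c d vector_scalar_commute)
  qed
  show ?thesis
  \<comment> \<open>Both sides are limits of one and the same function, rewritten by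
    \<open>swap\<close> for the second.\<close>
  proof (rule tendsto_unique[OF trivial_limit_at_right_real])
    show "((\<lambda>t. act (g t) \<mu> (unit_vec i) (unit_vec i) $ k * act (g t) \<mu> (unit_vec j) (unit_vec j) $ l)
        \<longlongrightarrow> \<nu> (unit_vec i) (unit_vec i) $ k * \<nu> (unit_vec j) (unit_vec j) $ l) (at_right 0)"
      by (intro tendsto_mult lim)
    show "((\<lambda>t. act (g t) \<mu> (unit_vec i) (unit_vec i) $ k * act (g t) \<mu> (unit_vec j) (unit_vec j) $ l)
        \<longlongrightarrow> \<nu> (unit_vec i) (unit_vec i) $ l * \<nu> (unit_vec j) (unit_vec j) $ k) (at_right 0)"
      unfolding swap by (intro tendsto_mult lim)
  qed
qed

text \<open>In a natural basis f, multiplying the square of f_i by f_l keeps only its f_l-component,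
  so the result is that coefficient times the square of f_l. It vanishes by \<open>cube\<close>, and
  the coordinates pass to the limit.\<close>

lemma degenerates_cube_zero:
  assumes deg: "degenerates \<mu> \<nu>" and bil: "complex_bilinear \<mu>"
    and cube: "\<And>x y z. \<mu> (\<mu> x y) z = 0"
  shows "\<nu> (unit_vec i) (unit_vec i) $ l * \<nu> (unit_vec l) (unit_vec l) $ k = 0"
proof -
  obtain g where nat: "eventually (\<lambda>t. natural_basis_change (g t) \<mu>) (at_right 0)"
    and lim: "\<And>i j k. ((\<lambda>t. act (g t) \<mu> (unit_vec i) (unit_vec j) $ k)
            \<longlongrightarrow> \<nu> (unit_vec i) (unit_vec j) $ k) (at_right (0::real))"
    using degenerates_limit[OF deg] by blast
  have zero: "act h \<mu> (unit_vec i) (unit_vec i) $ l * act h \<mu> (unit_vec l) (unit_vec l) $ k = 0"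
    if h: "natural_basis_change h \<mu>" for h
  proof -
    define x where "x = act h \<mu> (unit_vec i) (unit_vec i)"
    have act_zero: "act h \<mu> x (unit_vec l) = 0"
      using h unfolding x_def by (simp add: act_act natural_basis_change_def cube)
    have "x = (\<Sum>j\<in>UNIV. x $ j *s unit_vec j)"
      by (simp add: basis_expansion)
    then have "act h \<mu> x (unit_vec l) = (\<Sum>j\<in>UNIV. x $ j *s act h \<mu> (unit_vec j) (unit_vec l))"
      by (metis complex_bilinear_sum_left[OF complex_bilinear_act[OF bil]])
    also have "\<dots> = (\<Sum>j\<in>UNIV. if j = l then x $ l *s act h \<mu> (unit_vec l) (unit_vec l) else 0)"
      using h by (intro sum.cong) (auto simp: natural_basis_change_def)
    also have "\<dots> = x $ l *s act h \<mu> (unit_vec l) (unit_vec l)"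
      by (simp only: sum.delta finite UNIV_I if_True)
    finally have "x $ l *s act h \<mu> (unit_vec l) (unit_vec l) = 0"
      using act_zero by simp
    then show ?thesis unfolding x_def by (metis vector_smult_component zero_index)
  qed
  have "((\<lambda>t. 0) \<longlongrightarrow> \<nu> (unit_vec i) (unit_vec i) $ l * \<nu> (unit_vec l) (unit_vec l) $ k) (at_right (0::real))"
    by (rule Lim_transform_eventually[OF tendsto_mult[OF lim lim]])
       (use nat in \<open>rule eventually_mono; use zero in blast\<close>)
  then show ?thesis by (simp add: tendsto_const_iff)
qed

text \<open>
  The projections to the coordinates with \<open>s i \<noteq> 0\<close> do not change any product, and nonisotropic
  orthogonal vectors are linearly independent.
\<close>

lemma card_orthogonal_le:
  fixes s b :: "'n::finite \<Rightarrow> complex^'n"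
  assumes orth: "\<And>i j. i \<in> S \<Longrightarrow> j \<in> S \<Longrightarrow> i \<noteq> j \<Longrightarrow> evolution_product s (b i) (b j) = 0"
    and nz: "\<And>i. i \<in> S \<Longrightarrow> evolution_product s (b i) (b i) \<noteq> 0"
  shows "card S \<le> card {i. s i \<noteq> 0}"
proof -
  define p where "p i = (\<chi> l. if s l \<noteq> 0 then b i $ l else 0)" for i
  have prod: "evolution_product s (p i) (p j) = evolution_product s (b i) (b j)" for i j
    unfolding evolution_product_def p_def by (intro sum.cong) auto
  have inj: "inj_on p S"
    \<comment> \<open>If p i = p j for distinct i and j, the zero product of b i and b j would equal
      the nonzero square of b i.\<close>
    using orth nz prod by (metis inj_onI)
  have "vec.independent (p ` S)"
  proof (rule vec.independent_if_scalars_zero)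
    fix c x assume sum: "(\<Sum>v\<in>p ` S. c v *s v) = 0" and x: "x \<in> p ` S"
    from x obtain j where j: "j \<in> S" "x = p j" by blast
    \<comment> \<open>Multiplying a linear relation by one of its vectors isolates that vector's
      coefficient.\<close>
    have "0 = evolution_product s (\<Sum>v\<in>p ` S. c v *s v) x"
      by (simp add: sum complex_bilinear_zero_left complex_bilinear_evolution_product)
    also have "\<dots> = (\<Sum>v\<in>p ` S. c v *s evolution_product s v x)"
      by (rule complex_bilinear_sum_left[OF complex_bilinear_evolution_product])
    also have "\<dots> = (\<Sum>v\<in>p ` S. if v = x then c x *s evolution_product s x x else 0)"
    proof (intro sum.cong refl)
      fix v assume "v \<in> p ` S"
      then obtain i where "i \<in> S" "v = p i" by blast
      then show "c v *s evolution_product s v x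
          = (if v = x then c x *s evolution_product s x x else 0)"
        using orth[of i j] j inj_onD[OF inj, of i j] by (cases "i = j") (auto simp: prod)
    qed
    also have "\<dots> = c x *s evolution_product s x x"
      using x by (simp add: sum.delta)
    finally show "c x = 0"
      using nz[OF j(1)] by (simp add: j(2) prod)
  qed simp
  moreover have "p ` S \<subseteq> vec.span (unit_vec ` {i. s i \<noteq> 0})"
  proof clarify
    fix i
    have "p i = (\<Sum>l\<in>UNIV. p i $ l *s unit_vec l)"
      by (simp add: basis_expansion)
    also have "\<dots> = (\<Sum>l\<in>{i. s i \<noteq> 0}. p i $ l *s unit_vec l)"
      by (rule sum.mono_neutral_right) (auto simp: p_def)
    also have "\<dots> \<in> vec.span (unit_vec ` {i. s i \<noteq> 0})"
      by (intro vec.span_sum vec.span_scale vec.span_base imageI)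
    finally show "p i \<in> vec.span (unit_vec ` {i. s i \<noteq> 0})" .
  qed
  ultimately have "card (p ` S) \<le> card ((unit_vec :: 'n \<Rightarrow> complex^'n) ` {i. s i \<noteq> 0})"
    by (intro conjunct2[OF vec.independent_span_bound]) auto
  then show ?thesis
    using inj by (simp add: card_image inj_on_def axis_eq_axis)
qed

text \<open>Being nonzero is an open condition: for some small t every nonzero square of the limit
  is already nonzero. The columns of \<open>matrix_inv (g t)\<close> are then orthogonal, and
  \<open>card_orthogonal_le\<close> applies to those with nonzero square.\<close>

lemma degenerates_card_squares:
  assumes deg: "degenerates (evolution_product s) \<nu>"
  shows "card {i. \<nu> (unit_vec i) (unit_vec i) \<noteq> 0} \<le> card {i. s i \<noteq> 0}"
proof -
  obtain g where nat: "eventually (\<lambda>t. natural_basis_change (g t) (evolution_product s)) (at_right 0)"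
    and lim: "\<And>i j k. ((\<lambda>t. act (g t) (evolution_product s) (unit_vec i) (unit_vec j) $ k)
        \<longlongrightarrow> \<nu> (unit_vec i) (unit_vec j) $ k) (at_right (0::real))"
    using degenerates_limit[OF deg] by blast
  have "eventually (\<lambda>t. act (g t) (evolution_product s) (unit_vec i) (unit_vec i) \<noteq> 0) (at_right 0)"
    if i: "\<nu> (unit_vec i) (unit_vec i) \<noteq> 0" for i
  proof -
    obtain k where "\<nu> (unit_vec i) (unit_vec i) $ k \<noteq> 0" using i by (auto simp: vec_eq_iff)
    then have "eventually (\<lambda>t. act (g t) (evolution_product s) (unit_vec i) (unit_vec i) $ k \<noteq> 0) (at_right 0)"
      by (rule tendsto_imp_eventually_ne[OF lim])
    then show ?thesis by (rule eventually_mono) auto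
  qed
  then have "eventually (\<lambda>t. \<forall>i\<in>{i. \<nu> (unit_vec i) (unit_vec i) \<noteq> 0}.
      act (g t) (evolution_product s) (unit_vec i) (unit_vec i) \<noteq> 0) (at_right 0)"
    by (intro eventually_ball_finite) auto
  with nat have "eventually (\<lambda>t. natural_basis_change (g t) (evolution_product s) \<and> (\<forall>i\<in>{i. \<nu> (unit_vec i) (unit_vec i) \<noteq> 0}.
      act (g t) (evolution_product s) (unit_vec i) (unit_vec i) \<noteq> 0)) (at_right 0)"
    by (rule eventually_conj)
  then obtain t where t: "natural_basis_change (g t) (evolution_product s)"
    "\<forall>i\<in>{i. \<nu> (unit_vec i) (unit_vec i) \<noteq> 0}. act (g t) (evolution_product s) (unit_vec i) (unit_vec i) \<noteq> 0"
    using eventually_happens' trivial_limit_at_right_real by blast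
  have orth: "evolution_product s (matrix_inv (g t) *v unit_vec i) (matrix_inv (g t) *v unit_vec j) = 0"
    if "i \<noteq> j" for i j
  proof -
    have "g t *v evolution_product s (matrix_inv (g t) *v unit_vec i) (matrix_inv (g t) *v unit_vec j) = 0"
      using t(1) that by (simp add: natural_basis_change_def act_def)
    then have "(matrix_inv (g t) ** g t) *v
        evolution_product s (matrix_inv (g t) *v unit_vec i) (matrix_inv (g t) *v unit_vec j) = 0"
      by (simp flip: matrix_vector_mul_assoc)
    then show ?thesis
      using t(1) by (simp add: natural_basis_change_def matrix_inv_mult)
  qed
  show ?thesis
    by (rule card_orthogonal_le[of _ s "\<lambda>i. matrix_inv (g t) *v unit_vec i"])
       (use t(2) orth in \<open>auto simp: act_def\<close>)
qed

section \<open>Constructing degenerations\<close>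

text \<open>Polymorphic in the entries: it builds vectors, matrices as vectors of rows, and the
  weights for nilpotency.\<close>

definition vec4 :: "'a \<Rightarrow> 'a \<Rightarrow> 'a \<Rightarrow> 'a \<Rightarrow> 'a^4" where
  "vec4 a b c d = (\<chi> i. if i = 1 then a else if i = 2 then b else if i = 3 then c else d)"

lemma vec4_nth [simp]:
  "vec4 a b c d $ 1 = a" "vec4 a b c d $ 2 = b" "vec4 a b c d $ 3 = c" "vec4 a b c d $ 4 = d"
  by (simp_all add: vec4_def)

lemma continuous_on_vec4:
  fixes a :: "'a::topological_space \<Rightarrow> 'b::topological_space"
  assumes "continuous_on S a" "continuous_on S b" "continuous_on S c" "continuous_on S d"
  shows "continuous_on S (\<lambda>z. vec4 (a z) (b z) (c z) (d z))"
proof -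
  have "continuous_on S (\<lambda>z. vec4 (a z) (b z) (c z) (d z) $ i)" for i
    using exhaust_4[of i] assms by auto
  then have "continuous_on S (\<lambda>z. \<chi> i. vec4 (a z) (b z) (c z) (d z) $ i)"
    by (intro continuous_on_vec_lambda)
  then show ?thesis by simp
qed

lemma isCont_vec4:
  fixes a :: "'a::t2_space \<Rightarrow> 'b::topological_space"
  assumes "isCont a z" "isCont b z" "isCont c z" "isCont d z"
  shows "isCont (\<lambda>z. vec4 (a z) (b z) (c z) (d z)) z"
  unfolding isCont_def
proof (rule vec_tendstoI)
  fix i
  show "((\<lambda>z. vec4 (a z) (b z) (c z) (d z) $ i) \<longlongrightarrow> vec4 (a z) (b z) (c z) (d z) $ i) (at z)"
    using exhaust_4[of i] assms by (auto simp: isCont_def)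
qed

text \<open>
  The rows of \<open>B z\<close> are the new basis vectors, those of \<open>D z\<close> the old basis vectors in new
  coordinates, and those of \<open>C z\<close> the squares of the new basis vectors in new coordinates.
\<close>

lemma degeneratesI:
  fixes B C D :: "complex \<Rightarrow> complex^'n::finite^'n"
  assumes cont: "continuous_on (- {0}) D" and lim: "isCont C 0"
    and inv: "\<And>z. z \<noteq> 0 \<Longrightarrow> B z ** D z = mat 1"
    and orth: "\<And>z i j. z \<noteq> 0 \<Longrightarrow> i \<noteq> j \<Longrightarrow> \<mu> (B z $ i) (B z $ j) = 0"
    and square: "\<And>z i. z \<noteq> 0 \<Longrightarrow> \<mu> (B z $ i) (B z $ i) = C z $ i v* B z"
  shows "degenerates \<mu> (evolution_product (($) (C 0)))"
proof -
  \<comment> \<open>Matrices act on columns while B and D store vectors as rows, hence the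
    transposes; the inverse of \<open>g t\<close> sends the i-th unit vector to the i-th new basis
    vector.\<close>
  define g where "g t = transpose (D (complex_of_real t))" for t
  have gB: "g t ** transpose (B (complex_of_real t)) = mat 1" if "t \<noteq> 0" for t
    using inv[of "complex_of_real t"] that unfolding g_def
    by (metis matrix_transpose_mul of_real_eq_0_iff transpose_mat)
  have act: "act (g t) \<mu> (unit_vec i) (unit_vec j) = (if i = j then C (complex_of_real t) $ i else 0)"
    if t: "t \<noteq> 0" for t i j
  proof -
    have "matrix_inv (g t) *v unit_vec k = B (complex_of_real t) $ k" for k
      unfolding matrix_inv_eqI(2)[OF gB[OF t]]
      by (simp add: vec_eq_iff vector_matrix_mult_def axis_def if_distrib if_distribR cong: if_cong)
    then have act: "act (g t) \<mu> (unit_vec i) (unit_vec j)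
        = g t *v \<mu> (B (complex_of_real t) $ i) (B (complex_of_real t) $ j)"
      by (simp add: act_def)
    show ?thesis
    proof (cases "i = j")
      case True
      have "act (g t) \<mu> (unit_vec i) (unit_vec j)
          = g t *v (transpose (B (complex_of_real t)) *v C (complex_of_real t) $ i)"
        using t True act by (simp add: square)
      then show ?thesis
        using gB[OF t] True by (simp only: matrix_vector_mul_assoc matrix_vector_mul_lid if_True simp_thms)
    next
      case False
      then show ?thesis using t orth by (simp add: act)
    qed
  qed
  have "continuous_on {0<..1} g"
  proof -
    have "continuous_on {0<..1} (\<lambda>t. D (complex_of_real t))"
      by (rule continuous_on_compose2[OF cont]) (auto intro!: continuous_intros)
    then show ?thesis
      unfolding g_def transpose_def
      by (intro continuous_on_vec_lambda continuous_on_component)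
  qed
  moreover have "natural_basis_change (g t) \<mu>" if "t \<in> {0<..1}" for t
    using that act[of t] matrix_inv_eqI(1)[OF gB[of t]] by (auto simp: natural_basis_change_def)
  moreover have "((\<lambda>t. act (g t) \<mu> (unit_vec i) (unit_vec j) $ k)
      \<longlongrightarrow> evolution_product (($) (C 0)) (unit_vec i) (unit_vec j) $ k) (at_right 0)" for i j k
  proof -
    \<comment> \<open>D may have a pole at 0; only C has to be continuous there.\<close>
    have "((\<lambda>t. C (complex_of_real t)) \<longlongrightarrow> C 0) (at_right 0)"
      by (rule isCont_tendsto_compose[OF lim]) (auto intro!: tendsto_eq_intros)
    then have "((\<lambda>t. (if i = j then C (complex_of_real t) $ i else 0) $ k)
        \<longlongrightarrow> evolution_product (($) (C 0)) (unit_vec i) (unit_vec j) $ k) (at_right 0)"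
      by (auto simp: evolution_product_unit_vec intro!: tendsto_vec_nth)
    moreover have "eventually (\<lambda>t. act (g t) \<mu> (unit_vec i) (unit_vec j) $ k
        = (if i = j then C (complex_of_real t) $ i else 0) $ k) (at_right 0)"
      using eventually_at_right_less[of "0::real"] by (rule eventually_mono) (simp add: act)
    ultimately show ?thesis by (simp cong: tendsto_cong)
  qed
  ultimately show ?thesis unfolding degenerates_def by blast
qed

lemma squares4_eq: "squares4 a b c d = evolution_product (($) (vec4 a b c d))"
  unfolding squares4_def vec4_def by (intro arg_cong[where f = evolution_product] ext) simp

lemma squares4_apply:
  "squares4 a b c d x y = (x $ 1 * y $ 1) *s a + (x $ 2 * y $ 2) *s b + (x $ 3 * y $ 3) *s c + (x $ 4 * y $ 4) *s d"
  by (simp add: squares4_eq evolution_product_def sum_4)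

text \<open>Object-level quantifiers let \<open>forall_4\<close> expand the conditions into finitely
  many rational identities in z.\<close>

lemma degenerates_squares4I:
  fixes B C D :: "complex \<Rightarrow> complex^4^4"
  assumes "continuous_on (- {0}) D" "isCont C 0"
    and "\<And>z. z \<noteq> 0 \<Longrightarrow> B z ** D z = mat 1"
    and "\<And>z. z \<noteq> 0 \<Longrightarrow> \<forall>i j. i \<noteq> j \<longrightarrow> squares4 a b c d (B z $ i) (B z $ j) = 0"
    and "\<And>z. z \<noteq> 0 \<Longrightarrow> \<forall>i. squares4 a b c d (B z $ i) (B z $ i) = C z $ i v* B z"
    and "C 0 = vec4 a' b' c' d'"
  shows "degenerates (squares4 a b c d) (squares4 a' b' c' d')"
  using degeneratesI[of D C B "squares4 a b c d"] assms(1-5)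
  by (simp add: assms(6) squares4_eq[of a'])

section \<open>Explicit families of natural bases for the fourteen arrows\<close>

lemma mu4_simps:
  "mu4 1 = squares4 0 0 0 0"
  "mu4 2 = squares4 (unit_vec 2) 0 0 0"
  "mu4 3 = squares4 (unit_vec 3) (unit_vec 3) 0 0"
  "mu4 4 = squares4 (unit_vec 3) (unit_vec 4) 0 0"
  "mu4 5 = squares4 (unit_vec 2) (unit_vec 4) 0 0"
  "mu4 6 = squares4 (unit_vec 4) (unit_vec 4) (unit_vec 4) 0"
  "mu4 7 = squares4 (unit_vec 2) (unit_vec 4) (unit_vec 4) 0"
  "mu4 8 = squares4 (unit_vec 2 + \<i> *s unit_vec 3) (unit_vec 4) (unit_vec 4) 0"
  "mu4 9 = squares4 (unit_vec 3) (unit_vec 3) (unit_vec 4) 0"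
  "mu4 10 = squares4 (unit_vec 3) (unit_vec 3 + unit_vec 4) (unit_vec 4) 0"
  "mu4 11 = squares4 (unit_vec 2) (unit_vec 3) (unit_vec 4) 0"
  "mu4 12 = squares4 (unit_vec 2 + unit_vec 3) (unit_vec 3) (unit_vec 4) 0"
  by (simp_all add: mu4_def)

lemmas degenerate4_simps = vec_eq_iff forall_4 sum_4 matrix_matrix_mult_def vector_matrix_mult_def
  mat_def axis_def squares4_apply field_simps power_def

lemma degenerates_2_1: "degenerates (mu4 2) (mu4 1)"
  unfolding mu4_simps
  by (rule degenerates_squares4I[where
        B = "\<lambda>z. vec4 (vec4 z 0 0 0) (vec4 0 1 0 0) (vec4 0 0 1 0) (vec4 0 0 0 1)" and
        D = "\<lambda>z. vec4 (vec4 (1 / z) 0 0 0) (vec4 0 1 0 0) (vec4 0 0 1 0) (vec4 0 0 0 1)" and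
        C = "\<lambda>z. vec4 (vec4 0 (z^2) 0 0) (vec4 0 0 0 0) (vec4 0 0 0 0) (vec4 0 0 0 0)"])
     (auto simp: degenerate4_simps intro!: continuous_intros continuous_on_vec4 isCont_vec4)

text \<open>The vectors e2 and e3 trade places to match the target, and the factor z makes the
  square of the old e2 vanish in the limit.\<close>

lemma degenerates_3_2: "degenerates (mu4 3) (mu4 2)"
  unfolding mu4_simps
  by (rule degenerates_squares4I[where
        B = "\<lambda>z. vec4 (vec4 1 0 0 0) (vec4 0 0 1 0) (vec4 0 z 0 0) (vec4 0 0 0 1)" and
        D = "\<lambda>z. vec4 (vec4 1 0 0 0) (vec4 0 0 (1 / z) 0) (vec4 0 1 0 0) (vec4 0 0 0 1)" and
        C = "\<lambda>z. vec4 (vec4 0 1 0 0) (vec4 0 0 0 0) (vec4 0 (z^2) 0 0) (vec4 0 0 0 0)"])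
     (auto simp: degenerate4_simps intro!: continuous_intros continuous_on_vec4 isCont_vec4)

text \<open>With f4 = (e4 - e3)/z one has e4 = e3 + z f4, so both nonzero squares tend to
  e3.\<close>

lemma degenerates_4_3: "degenerates (mu4 4) (mu4 3)"
  unfolding mu4_simps
  by (rule degenerates_squares4I[where
        B = "\<lambda>z. vec4 (vec4 1 0 0 0) (vec4 0 1 0 0) (vec4 0 0 1 0) (vec4 0 0 (-1 / z) (1 / z))" and
        D = "\<lambda>z. vec4 (vec4 1 0 0 0) (vec4 0 1 0 0) (vec4 0 0 1 0) (vec4 0 0 1 z)" and
        C = "\<lambda>z. vec4 (vec4 0 0 1 0) (vec4 0 0 1 z) (vec4 0 0 0 0) (vec4 0 0 0 0)"])
     (auto simp: degenerate4_simps intro!: continuous_intros continuous_on_vec4 isCont_vec4)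

text \<open>Here e2 = z f2 + f3, so the square of e1 moves from e2 to f3, while f4 absorbs the
  factor in the square of f2.\<close>

lemma degenerates_5_4: "degenerates (mu4 5) (mu4 4)"
  unfolding mu4_simps
  by (rule degenerates_squares4I[where
        B = "\<lambda>z. vec4 (vec4 1 0 0 0) (vec4 0 (1 / z) (-1) 0) (vec4 0 0 z 0) (vec4 0 0 0 (1 / z^2))" and
        D = "\<lambda>z. vec4 (vec4 1 0 0 0) (vec4 0 z 1 0) (vec4 0 0 (1 / z) 0) (vec4 0 0 0 (z^2))" and
        C = "\<lambda>z. vec4 (vec4 0 z 1 0) (vec4 0 0 0 1) (vec4 0 0 0 0) (vec4 0 0 0 0)"])
     (auto simp: degenerate4_simps intro!: continuous_intros continuous_on_vec4 isCont_vec4)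

lemma degenerates_6_3: "degenerates (mu4 6) (mu4 3)"
  unfolding mu4_simps
  by (rule degenerates_squares4I[where
        B = "\<lambda>z. vec4 (vec4 1 0 0 0) (vec4 0 1 0 0) (vec4 0 0 0 1) (vec4 0 0 z 0)" and
        D = "\<lambda>z. vec4 (vec4 1 0 0 0) (vec4 0 1 0 0) (vec4 0 0 0 (1 / z)) (vec4 0 0 1 0)" and
        C = "\<lambda>z. vec4 (vec4 0 0 1 0) (vec4 0 0 1 0) (vec4 0 0 0 0) (vec4 0 0 (z^2) 0)"])
     (auto simp: degenerate4_simps intro!: continuous_intros continuous_on_vec4 isCont_vec4)

lemma degenerates_7_5: "degenerates (mu4 7) (mu4 5)"
  unfolding mu4_simps
  by (rule degenerates_squares4I[where
        B = "\<lambda>z. vec4 (vec4 1 0 0 0) (vec4 0 1 0 0) (vec4 0 0 z 0) (vec4 0 0 0 1)" and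
        D = "\<lambda>z. vec4 (vec4 1 0 0 0) (vec4 0 1 0 0) (vec4 0 0 (1 / z) 0) (vec4 0 0 0 1)" and
        C = "\<lambda>z. vec4 (vec4 0 1 0 0) (vec4 0 0 0 1) (vec4 0 0 0 (z^2)) (vec4 0 0 0 0)"])
     (auto simp: degenerate4_simps intro!: continuous_intros continuous_on_vec4 isCont_vec4)

text \<open>Since e4 annihilates the algebra, correcting e2/z by a multiple of e4 changes no
  product. It gives e2 = z f2 + f4, so the square of e1 tends to f4.\<close>

lemma degenerates_7_6: "degenerates (mu4 7) (mu4 6)"
  unfolding mu4_simps
  by (rule degenerates_squares4I[where
        B = "\<lambda>z. vec4 (vec4 1 0 0 0) (vec4 0 (1 / z) 0 (-1 / z^3)) (vec4 0 0 (1 / z) 0) (vec4 0 0 0 (1 / z^2))" and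
        D = "\<lambda>z. vec4 (vec4 1 0 0 0) (vec4 0 z 0 1) (vec4 0 0 z 0) (vec4 0 0 0 (z^2))" and
        C = "\<lambda>z. vec4 (vec4 0 z 0 1) (vec4 0 0 0 1) (vec4 0 0 0 1) (vec4 0 0 0 0)"])
     (auto simp: degenerate4_simps intro!: continuous_intros continuous_on_vec4 isCont_vec4)

text \<open>The basis is that for \<open>mu4 7\<close>; the additional summand of the first square
  becomes \<open>\<i> * z\<close> times f3 and vanishes.\<close>

lemma degenerates_8_6: "degenerates (mu4 8) (mu4 6)"
  unfolding mu4_simps
  by (rule degenerates_squares4I[where
        B = "\<lambda>z. vec4 (vec4 1 0 0 0) (vec4 0 (1 / z) 0 (-1 / z^3)) (vec4 0 0 (1 / z) 0) (vec4 0 0 0 (1 / z^2))" and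
        D = "\<lambda>z. vec4 (vec4 1 0 0 0) (vec4 0 z 0 1) (vec4 0 0 z 0) (vec4 0 0 0 (z^2))" and
        C = "\<lambda>z. vec4 (vec4 0 z (\<i> * z) 1) (vec4 0 0 0 1) (vec4 0 0 0 1) (vec4 0 0 0 0)"])
     (auto simp: degenerate4_simps intro!: continuous_intros continuous_on_vec4 isCont_vec4)

text \<open>The same correction by e4, applied to e3, gives e3 = z f3 + f4.\<close>

lemma degenerates_9_6: "degenerates (mu4 9) (mu4 6)"
  unfolding mu4_simps
  by (rule degenerates_squares4I[where
        B = "\<lambda>z. vec4 (vec4 1 0 0 0) (vec4 0 1 0 0) (vec4 0 0 (1 / z) (-1 / z^3)) (vec4 0 0 0 (1 / z^2))" and
        D = "\<lambda>z. vec4 (vec4 1 0 0 0) (vec4 0 1 0 0) (vec4 0 0 z 1) (vec4 0 0 0 (z^2))" and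
        C = "\<lambda>z. vec4 (vec4 0 0 z 1) (vec4 0 0 z 1) (vec4 0 0 0 1) (vec4 0 0 0 0)"])
     (auto simp: degenerate4_simps intro!: continuous_intros continuous_on_vec4 isCont_vec4)

text \<open>Scaling by powers of 1/z with exponents 1, 1, 2, 4 preserves the products of the target
  and gives the extra e4 the coefficient \<open>z^2\<close>.\<close>

lemma degenerates_10_9: "degenerates (mu4 10) (mu4 9)"
  unfolding mu4_simps
  by (rule degenerates_squares4I[where
        B = "\<lambda>z. vec4 (vec4 (1 / z) 0 0 0) (vec4 0 (1 / z) 0 0) (vec4 0 0 (1 / z^2) 0) (vec4 0 0 0 (1 / z^4))" and
        D = "\<lambda>z. vec4 (vec4 z 0 0 0) (vec4 0 z 0 0) (vec4 0 0 (z^2) 0) (vec4 0 0 0 (z^4))" and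
        C = "\<lambda>z. vec4 (vec4 0 0 1 0) (vec4 0 0 1 (z^2)) (vec4 0 0 0 1) (vec4 0 0 0 0)"])
     (auto simp: degenerate4_simps intro!: continuous_intros continuous_on_vec4 isCont_vec4)

lemma degenerates_11_7: "degenerates (mu4 11) (mu4 7)"
  unfolding mu4_simps
  by (rule degenerates_squares4I[where
        B = "\<lambda>z. vec4 (vec4 1 0 0 0) (vec4 0 1 0 0) (vec4 0 0 (1 / z) (-1 / z^3)) (vec4 0 0 0 (1 / z^2))" and
        D = "\<lambda>z. vec4 (vec4 1 0 0 0) (vec4 0 1 0 0) (vec4 0 0 z 1) (vec4 0 0 0 (z^2))" and
        C = "\<lambda>z. vec4 (vec4 0 1 0 0) (vec4 0 0 z 1) (vec4 0 0 0 1) (vec4 0 0 0 0)"])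
     (auto simp: degenerate4_simps intro!: continuous_intros continuous_on_vec4 isCont_vec4)

text \<open>The corrections of e2 by -e4 and of e3 by +e4 cancel in e2 + e3 but leave -e4 in the
  square of e2. The factor \<open>-\<i>\<close> in f3 gives its square the same sign and produces
  the coefficient \<open>\<i>\<close> in the first square.\<close>

lemma degenerates_12_8: "degenerates (mu4 12) (mu4 8)"
  unfolding mu4_simps
  by (rule degenerates_squares4I[where
        B = "\<lambda>z. vec4 (vec4 z 0 0 0) (vec4 0 (z^2) 0 (-(z^2))) (vec4 0 0 (-\<i> * z^2) (-\<i> * z^2)) (vec4 0 0 0 (-(z^4)))" and
        D = "\<lambda>z. vec4 (vec4 (1 / z) 0 0 0) (vec4 0 (1 / z^2) 0 (-1 / z^4)) (vec4 0 0 (\<i> / z^2) (1 / z^4)) (vec4 0 0 0 (-1 / z^4))" and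
        C = "\<lambda>z. vec4 (vec4 0 1 \<i> 0) (vec4 0 0 (\<i> * z^2) 1) (vec4 0 0 0 1) (vec4 0 0 0 0)"])
     (auto simp: degenerate4_simps intro!: continuous_intros continuous_on_vec4 isCont_vec4)

text \<open>Again the e4-corrections cancel in the first square, while the second, expressed through
  f3, gains f4.\<close>

lemma degenerates_12_10: "degenerates (mu4 12) (mu4 10)"
  unfolding mu4_simps
  by (rule degenerates_squares4I[where
        B = "\<lambda>z. vec4 (vec4 z 0 0 0) (vec4 0 z 0 (z^3)) (vec4 0 0 (z^2) (-(z^4))) (vec4 0 0 0 (z^4))" and
        D = "\<lambda>z. vec4 (vec4 (1 / z) 0 0 0) (vec4 0 (1 / z) 0 (-1 / z^2)) (vec4 0 0 (1 / z^2) (1 / z^2)) (vec4 0 0 0 (1 / z^4))" and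
        C = "\<lambda>z. vec4 (vec4 0 z 1 0) (vec4 0 0 1 1) (vec4 0 0 0 1) (vec4 0 0 0 0)"])
     (auto simp: degenerate4_simps intro!: continuous_intros continuous_on_vec4 isCont_vec4)

text \<open>Scaling exponents 1, 2, 4, 8 respect the chain of squares; the extra e3 is two powers of
  z smaller.\<close>

lemma degenerates_12_11: "degenerates (mu4 12) (mu4 11)"
  unfolding mu4_simps
  by (rule degenerates_squares4I[where
        B = "\<lambda>z. vec4 (vec4 (1 / z) 0 0 0) (vec4 0 (1 / z^2) 0 0) (vec4 0 0 (1 / z^4) 0) (vec4 0 0 0 (1 / z^8))" and
        D = "\<lambda>z. vec4 (vec4 z 0 0 0) (vec4 0 (z^2) 0 0) (vec4 0 0 (z^4) 0) (vec4 0 0 0 (z^8))" and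
        C = "\<lambda>z. vec4 (vec4 0 1 (z^2) 0) (vec4 0 0 1 0) (vec4 0 0 0 1) (vec4 0 0 0 0)"])
     (auto simp: degenerate4_simps intro!: continuous_intros continuous_on_vec4 isCont_vec4)

section \<open>Transitive degenerations among nilpotent algebras\<close>

lemma transitively_degenerates_refl:
  assumes "\<mu> \<in> F"
  shows "transitively_degenerates F \<mu> \<mu>"
  unfolding transitively_degenerates_def
  by (rule exI[of _ 0], rule exI[of _ "\<lambda>_. \<mu>"]) (simp add: assms)

lemma transitively_degenerates_step:
  assumes "transitively_degenerates F \<mu> \<nu>" "degenerates \<nu> \<kappa>" "\<kappa> \<in> F"
  shows "transitively_degenerates F \<mu> \<kappa>"
proof -
  obtain k \<sigma> where \<sigma>: "\<sigma> 0 = \<mu>" "\<sigma> k = \<nu>" "\<forall>m\<le>k. \<sigma> m \<in> F"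
    "\<forall>m<k. degenerates (\<sigma> m) (\<sigma> (Suc m))"
    using assms(1) unfolding transitively_degenerates_def by blast
  show ?thesis
    unfolding transitively_degenerates_def
    by (rule exI[of _ "Suc k"], rule exI[of _ "\<sigma>(Suc k := \<kappa>)"])
       (use \<sigma> assms(2,3) in \<open>auto simp: le_Suc_eq less_Suc_eq\<close>)
qed

lemma transitively_degenerates_trancl:
  assumes "(i, j) \<in> R\<^sup>+"
    and "\<And>i j. (i, j) \<in> R \<Longrightarrow> f i \<in> F \<and> f j \<in> F \<and> degenerates (f i) (f j)"
  shows "transitively_degenerates F (f i) (f j)"
  using assms(1)
  by (induction rule: trancl_induct)
     (use assms(2) in \<open>blast intro: transitively_degenerates_step transitively_degenerates_refl\<close>)+

text \<open>Each square involves only later basis vectors, and the weights 1, 2, 4, 8 at least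
  double from an index to any later one.\<close>

lemma squares4_in_N4:
  assumes "a $ 1 = 0" "b $ 1 = 0" "b $ 2 = 0" "c $ 1 = 0" "c $ 2 = 0" "c $ 3 = 0"
  shows "squares4 a b c 0 \<in> N4"
proof -
  let ?w = "\<lambda>i. vec4 1 2 4 8 $ i :: nat"
  have "2 * ?w i \<le> ?w k" if "vec4 a b c 0 $ i $ k \<noteq> 0" for i k
    using exhaust_4[of i] exhaust_4[of k] that assms by auto
  moreover have "0 < ?w i" for i
    using exhaust_4[of i] by auto
  ultimately show ?thesis
    unfolding N4_def squares4_eq
    using evolution_algebra_evolution_product nilpotent_evolution_product[of _ ?w] by blast
qed

lemma mu4_in_N4:
  assumes "i \<in> {1..12}"
  shows "mu4 i \<in> N4"
proof -
  have "i = 1 \<or> i = 2 \<or> i = 3 \<or> i = 4 \<or> i = 5 \<or> i = 6 \<or> i = 7 \<or> i = 8 \<or> i = 9 \<or> i = 10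
      \<or> i = 11 \<or> i = 12"
    using assms by (simp, presburger)
  then show ?thesis
    by (elim disjE; hypsubst; unfold mu4_simps; intro squares4_in_N4; simp add: axis_def)
qed

lemma arrows_degenerate:
  assumes "(i, j) \<in> arrows"
  shows "mu4 i \<in> N4 \<and> mu4 j \<in> N4 \<and> degenerates (mu4 i) (mu4 j)"
proof -
  have "i \<in> {1..12} \<and> j \<in> {1..12}"
    using assms unfolding arrows_def by auto
  moreover have "degenerates (mu4 i) (mu4 j)"
    using assms unfolding arrows_def
    by (elim insertE emptyE; clarsimp simp only: prod.inject)
       (rule degenerates_12_11 degenerates_12_10 degenerates_12_8 degenerates_11_7
         degenerates_10_9 degenerates_9_6 degenerates_8_6 degenerates_7_6 degenerates_7_5
         degenerates_6_3 degenerates_5_4 degenerates_4_3 degenerates_3_2 degenerates_2_1)+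
  ultimately show ?thesis using mu4_in_N4 by blast
qed

section \<open>Excluding all other degenerations among the first seven algebras\<close>

lemma squares4_unit_vec:
  "squares4 a b c d (unit_vec i) (unit_vec i) = vec4 a b c d $ i"
  by (simp add: squares4_eq evolution_product_unit_vec)

lemma unit_vec_nth: "unit_vec i $ j = (if j = i then 1 else 0)"
  by (simp add: axis_def)

lemma card_squares4:
  "card {i. squares4 a b c d (unit_vec i) (unit_vec i) \<noteq> 0}
     = of_bool (a \<noteq> 0) + of_bool (b \<noteq> 0) + of_bool (c \<noteq> 0) + of_bool (d \<noteq> 0)"
proof -
  have "card {i. vec4 a b c d $ i \<noteq> 0} = (\<Sum>i\<in>UNIV. of_bool (vec4 a b c d $ i \<noteq> 0))"
    by (simp add: of_bool_def sum.If_cases)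
  then show ?thesis by (simp add: squares4_unit_vec sum_4)
qed

lemma degenerates_mu4_card:
  assumes "i \<in> {1..7}" "j \<in> {1..7}" "degenerates (mu4 i) (mu4 j)"
  shows "i = 1 \<longrightarrow> j = 1" "i = 2 \<longrightarrow> j \<le> 2" "i \<le> 5 \<longrightarrow> j \<le> 5"
proof -
  have cases: "n = 1 \<or> n = 2 \<or> n = 3 \<or> n = 4 \<or> n = 5 \<or> n = 6 \<or> n = 7"
    if "n \<in> {1..7}" for n :: nat
    using that by (simp, presburger)
  \<comment> \<open>The leading 0 fills index 0, so that entry n belongs to
    \<open>mu4 n\<close>.\<close>
  define r where "r n = [0, 0, 1, 2, 2, 2, 3, 3 :: nat] ! n" for n
  have r: "card {i. mu4 n (unit_vec i) (unit_vec i) \<noteq> 0} = r n" if "n \<in> {1..7}" for n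
    using cases[OF that]
    by (elim disjE; hypsubst; unfold mu4_simps card_squares4) (simp_all add: r_def axis_eq_0_iff)
  obtain s where s: "mu4 i = evolution_product s"
    using cases[OF assms(1)] by (elim disjE; hypsubst; unfold mu4_simps squares4_eq; blast)
  have "r j \<le> r i"
    using degenerates_card_squares[OF assms(3)[unfolded s]] r[OF assms(1)] r[OF assms(2)]
    by (simp add: s evolution_product_unit_vec)
  then show "i = 1 \<longrightarrow> j = 1" "i = 2 \<longrightarrow> j \<le> 2" "i \<le> 5 \<longrightarrow> j \<le> 5"
    using cases[OF assms(1)] cases[OF assms(2)] by (elim disjE; simp add: r_def)+
qed

lemma not_degenerates_parallel:
  assumes "i \<in> {3, 6}" "j \<in> {4, 5, 7}"
  shows "\<not> degenerates (mu4 i) (mu4 j)"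
proof
  assume deg: "degenerates (mu4 i) (mu4 j)"
  have "\<exists>v. \<forall>x y. \<exists>c. mu4 i x y = c *s v"
  proof -
    have "\<forall>x y. \<exists>c. mu4 3 x y = c *s unit_vec 3" "\<forall>x y. \<exists>c. mu4 6 x y = c *s unit_vec 4"
      unfolding mu4_simps squares4_apply
      by (simp_all only: vector_smult_rzero add_0_right vec.scale_left_distrib[symmetric]) blast+
    then show ?thesis using assms(1) by blast
  qed
  then obtain v where "\<And>x y. \<exists>c. mu4 i x y = c *s v" by blast
  \<comment> \<open>The minor of the first two squares in columns k and 4 is nonzero for
    \<open>mu4 4\<close> with k = 3, and for \<open>mu4 5\<close> and \<open>mu4 7\<close> with k =
    2.\<close>
  note minor = degenerates_parallel_squares[OF deg this, of 1 _ 2 4]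
  show False
    using assms(2) minor[of 2] minor[of 3]
    by (auto simp: mu4_simps squares4_unit_vec unit_vec_nth)
qed

text \<open>The other two invariants agree on these algebras. In \<open>mu4 5\<close> the square of
  e1 times e2 is e4, whereas all such triple products vanish in \<open>mu4 4\<close>.\<close>

lemma not_degenerates_4_5: "\<not> degenerates (mu4 4) (mu4 5)"
proof
  assume "degenerates (mu4 4) (mu4 5)"
  moreover have "complex_bilinear (mu4 4)"
    by (simp add: mu4_simps squares4_eq complex_bilinear_evolution_product)
  moreover have "mu4 4 (mu4 4 x y) z = 0" for x y z
    by (simp add: mu4_simps squares4_apply axis_def)
  ultimately show False
    using degenerates_cube_zero[of "mu4 4" "mu4 5" 1 2 4]
    by (simp add: mu4_simps squares4_unit_vec unit_vec_nth)
qed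

lemma arrows7_descending:
  assumes "1 \<le> j" "j \<le> i" "i \<le> 5"
  shows "(i, j) \<in> arrows7\<^sup>*"
  using assms(2,3)
proof (induction i rule: dec_induct)
  case (step n)
  then have "n = 1 \<or> n = 2 \<or> n = 3 \<or> n = 4"
    using assms(1) by linarith
  then have "(Suc n, n) \<in> arrows7"
    by (auto simp: arrows7_def)
  with step show ?case by (auto intro: converse_rtrancl_into_rtrancl)
qed simp

text \<open>The invariants leave j at most i for i up to 5, j in {1, 2, 3, 6} for i = 6, and every j
  for i = 7; all of these are reached along arrows.\<close>

lemma degenerates_arrows7:
  assumes i: "i \<in> {1..7}" and j: "j \<in> {1..7}" and deg: "degenerates (mu4 i) (mu4 j)"
  shows "(i, j) \<in> arrows7\<^sup>*"
proof -
  note bounds = degenerates_mu4_card[OF i j deg]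
  have parallel: "i \<in> {3, 6} \<longrightarrow> j \<notin> {4, 5, 7}"
    using not_degenerates_parallel deg by blast
  have cube: "i = 4 \<longrightarrow> j \<noteq> 5"
    using not_degenerates_4_5 deg by blast
  have edges: "(6, 3) \<in> arrows7" "(7, 5) \<in> arrows7" "(7, 6) \<in> arrows7"
    by (simp_all add: arrows7_def)
  consider "i \<le> 5" | "i = 6" | "i = 7" using i by force
  then show ?thesis
  proof cases
    case 1
    then have "j \<le> i"
      using i j bounds parallel cube by (simp, presburger)
    with 1 j show ?thesis by (auto intro: arrows7_descending)
  next
    case 2
    then have "j \<le> 3 \<or> j = 6"
      using j parallel by (simp, presburger)
    with 2 j show ?thesis
      using arrows7_descending[of j 3] edges(1) by (auto intro: converse_rtrancl_into_rtrancl)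
  next
    case 3
    have "j \<le> 5 \<or> j = 6 \<or> j = 7" using j by force
    with 3 j show ?thesis
      using arrows7_descending[of j 5] edges(2,3) by (auto intro: converse_rtrancl_into_rtrancl)
  qed
qed

text \<open>The constant identity path works. Reflexivity stands in for injectivity of
  \<open>mu4\<close> when an algebra in a chain has to be matched with an index.\<close>

lemma degenerates_refl:
  assumes "evolution_algebra \<mu>"
  shows "degenerates \<mu> \<mu>"
  unfolding degenerates_def
  by (rule exI[of _ "\<lambda>_. mat 1"])
     (use assms in \<open>auto simp: act_def natural_basis_change_def matrix_inv_eqI[of "mat 1" "mat 1"]
        evolution_algebra_def natural_basis_def\<close>)

lemma transitively_degenerates_arrows7:
  assumes td: "transitively_degenerates (mu4 ` {1..7}) (mu4 i) (mu4 j)"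
    and i: "i \<in> {1..7}" and j: "j \<in> {1..7}"
  shows "(i, j) \<in> arrows7\<^sup>*"
proof -
  obtain k \<sigma> where \<sigma>: "\<sigma> 0 = mu4 i" "\<sigma> k = mu4 j" "\<forall>m\<le>k. \<sigma> m \<in> mu4 ` {1..7}"
    "\<forall>m<k. degenerates (\<sigma> m) (\<sigma> (Suc m))"
    using td unfolding transitively_degenerates_def by blast
  \<comment> \<open>The claim covers every index b naming the m-th algebra, so no choice of index
    has to be kept consistent along the chain.\<close>
  have "\<forall>b\<in>{1..7}. \<sigma> m = mu4 b \<longrightarrow> (i, b) \<in> arrows7\<^sup>*" if "m \<le> k" for m
    using that
  proof (induction m)
    case 0
    have "mu4 i \<in> N4" using i by (intro mu4_in_N4) auto
    then have "degenerates (mu4 i) (mu4 i)"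
      by (simp add: N4_def degenerates_refl)
    with \<sigma>(1) i show ?case by (metis degenerates_arrows7)
  next
    case (Suc m)
    obtain a where "a \<in> {1..7}" "\<sigma> m = mu4 a"
      using \<sigma>(3) Suc.prems by (metis Suc_leD imageE)
    with Suc \<sigma>(4) show ?case
      by (metis Suc_le_eq Suc_leD degenerates_arrows7 rtrancl_trans)
  qed
  with \<sigma>(2) j show ?thesis by blast
qed

theorem proposition5p15:
  shows "(\<forall>(i, j)\<in>arrows. mu4 i \<in> N4 \<and> mu4 j \<in> N4 \<and> degenerates (mu4 i) (mu4 j)) \<and>
    (\<forall>(i, j)\<in>arrows\<^sup>+. transitively_degenerates N4 (mu4 i) (mu4 j)) \<and>
    (\<forall>i\<in>{1..7}. \<forall>j\<in>{1..7}. i \<noteq> j \<longrightarrow>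
       (transitively_degenerates (mu4 ` {1..7}) (mu4 i) (mu4 j) \<longleftrightarrow> (i, j) \<in> arrows7\<^sup>+))"
proof (intro conjI ballI impI)
  have "mu4 i \<in> mu4 ` {1..7} \<and> mu4 j \<in> mu4 ` {1..7} \<and> degenerates (mu4 i) (mu4 j)"
    if "(i, j) \<in> arrows7" for i j
  proof -
    have "(i, j) \<in> arrows" "i \<in> {1..7}" "j \<in> {1..7}"
      using that by (auto simp: arrows7_def arrows_def)
    then show ?thesis using arrows_degenerate by blast
  qed
  then have "transitively_degenerates (mu4 ` {1..7}) (mu4 i) (mu4 j)"
    if "(i, j) \<in> arrows7\<^sup>+" for i j
    using transitively_degenerates_trancl[OF that, of mu4] by blast
  then show "transitively_degenerates (mu4 ` {1..7}) (mu4 i) (mu4 j) \<longleftrightarrow> (i, j) \<in> arrows7\<^sup>+"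
    if "i \<in> {1..7}" "j \<in> {1..7}" "i \<noteq> j" for i j
    using transitively_degenerates_arrows7[of i j] that by (metis rtranclD)
next
  show "case p of (i, j) \<Rightarrow> mu4 i \<in> N4 \<and> mu4 j \<in> N4 \<and> degenerates (mu4 i) (mu4 j)"
    if "p \<in> arrows" for p
    using that arrows_degenerate by (cases p) auto
  show "case p of (i, j) \<Rightarrow> transitively_degenerates N4 (mu4 i) (mu4 j)"
    if "p \<in> arrows\<^sup>+" for p
    using that transitively_degenerates_trancl[of _ _ arrows mu4 N4] arrows_degenerate
    by (cases p) auto
qed

end
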